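(* Let $n\geq 3$ and let $\mathbb{j}_{n}=\mathrm{circ}(j_{0},j_{1},\ldots ,j_{n-1})$. Then $$\det (\mathbb{j}_{n})=(2-j_{n})^{n-2}(4-j_{n-1})+\sum_{k=2}^{n-1}\left[ (2j_{k}-j_{k-1})(2-j_{n})^{k-2}(1+2j_{n-1})^{n-k}\right].$$
   Context: The Jacobsthal-Lucas numbers are defined by $j_0=2$, $j_1=1$, $j_{k}=j_{k-1}+2j_{k-2}$ for $k\ge 2$. For numbers $c_0,\dots,c_{n-1}$, $\mathrm{circ}(c_0,c_1,\ldots,c_{n-1})$ denotes the $n\times n$ circulant matrix whose first row is $(c_0,c_1,\ldots,c_{n-1})$ and each of whose later rows is the cyclic right shift by one of the row above; i.e. the $(i,j)$ entry ($1\le i,j\le n$) is $c_{(j-i)\bmod n}$. *)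

theory Defs
  imports "Jordan_Normal_Form.Determinant"
begin

fun jacobsthal_lucas :: "nat \<Rightarrow> int" where
  "jacobsthal_lucas 0 = 2"
| "jacobsthal_lucas (Suc 0) = 1"
| "jacobsthal_lucas (Suc (Suc k)) = jacobsthal_lucas (Suc k) + 2 * jacobsthal_lucas k"

text \<open>
  The circulant matrix with first row \<open>c\<close>. The difference of column and row index is taken
  in the integers, since subtraction of natural numbers would truncate it. Indices start at 0;
  as only this difference matters, the entries agree with those under indexing from 1.
\<close>
definition circ :: "'a vec \<Rightarrow> 'a mat" where
  "circ c = mat (dim_vec c) (dim_vec c)
     (\<lambda>(i, j). c $ nat ((int j - int i) mod int (dim_vec c)))"

end

theory Submission
  imports Defs
begin

text \<open>
  Each row of the circulant matrix is the cyclic shift of the previous one, so the recurrence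
  \<open>j (k + 2) = j (k + 1) + 2 * j k\<close> makes row \<open>i\<close> minus row \<open>i + 1\<close> minus twice row \<open>i + 2\<close> vanish
  except at the wrap-around, where \<open>2 - j n\<close> and \<open>- (1 + 2 * j (n - 1))\<close> remain. Doing this for
  all but the last two rows leaves a bidiagonal block. Subtracting twice the penultimate row from
  the last one then makes the entry \<open>1\<close> the only nonzero entry of the last column; expanding
  along that column yields a bidiagonal matrix bordered by one full row.
\<close>

lemma circ_vec_index:
  assumes "i < n" "j < n"
  shows "circ (vec n f) $$ (i, j) = (if i \<le> j then f (j - i) else f (n + j - i))"
proof (cases "i \<le> j")
  case True
  then have "nat ((int j - int i) mod int n) = j - i"
    using assms by (simp add: nat_diff_distrib)
  then show ?thesis using assms True by (simp add: circ_def)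
next
  case False
  then have "(int j - int i) mod int n = (int j - int i + int n) mod int n"
    by simp
  also have "\<dots> = int j - int i + int n"
    using assms False by (intro mod_pos_pos_trivial) auto
  finally have "nat ((int j - int i) mod int n) = n + j - i"
    using assms by simp
  then show ?thesis using assms False by (simp add: circ_def)
qed

text \<open>Expansion along the first column: apart from the top and bottom entries it is zero. The
  minor of the top entry has the same shape with \<open>s\<close> shifted, hence the induction over
  arbitrary \<open>s\<close>. The minor of the bottom entry is triangular with diagonal
  \<open>- b\<close>, and its sign cancels the cofactor sign.\<close>

lemma det_bidiagonal_bordered:
  fixes a b :: "'a :: comm_ring_1"
  shows "det (mat (Suc m) (Suc m) (\<lambda>(i, j).
      if i < m then if j = i then a else if j = Suc i then - b else 0 else s j)) =
    (\<Sum>k\<le>m. s k * a ^ k * b ^ (m - k))"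
proof (induction m arbitrary: s)
  case 0
  show ?case by (subst det_single) auto
next
  case (Suc m)
  let ?A = "\<lambda>m s. mat (Suc m) (Suc m) (\<lambda>(i, j).
      if i < m then if j = i then a else if j = Suc i then - b else 0 else s j)"
  let ?M = "?A (Suc m) s"
  have del0: "mat_delete ?M 0 0 = ?A m (\<lambda>k. s (Suc k))"
    by (rule eq_matI) (auto simp: mat_delete_def)
  let ?L = "mat_delete ?M (Suc m) 0"
  have L: "?L = mat (Suc m) (Suc m) (\<lambda>(i, j).
      if Suc j = i then a else if j = i then - b else 0)"
    by (rule eq_matI) (auto simp: mat_delete_def)
  have detL: "det ?L = (- b) ^ Suc m"
  proof -
    have "det ?L = prod_list (diag_mat ?L)"
      by (rule det_lower_triangular[where n = "Suc m"]) (auto simp: L)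
    also have "diag_mat ?L = map (\<lambda>i. - b) [0..<Suc m]"
      unfolding L diag_mat_def by (intro map_cong) auto
    finally show ?thesis by (simp add: map_replicate_const)
  qed
  have "det ?M = (\<Sum>i<Suc (Suc m). ?M $$ (i, 0) * cofactor ?M i 0)"
    by (rule laplace_expansion_column) auto
  also have "\<dots> = (\<Sum>i\<in>{0, Suc m}. ?M $$ (i, 0) * cofactor ?M i 0)"
    by (rule sum.mono_neutral_right) auto
  also have "\<dots> = a * det (?A m (\<lambda>k. s (Suc k))) + s 0 * ((- 1) ^ Suc m * (- b) ^ Suc m)"
    by (simp add: cofactor_def del0 detL del: power_Suc)
  also have "(- 1) ^ Suc m * (- b) ^ Suc m = b ^ Suc m"
    by (simp flip: power_mult_distrib del: power_Suc)
  also have "a * det (?A m (\<lambda>k. s (Suc k))) = (\<Sum>k\<le>m. s (Suc k) * a ^ Suc k * b ^ (m - k))"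
    by (simp add: Suc.IH sum_distrib_left ac_simps)
  finally show ?case
    by (subst sum.atMost_Suc_shift) (simp add: ac_simps)
qed

theorem theorem2:
  fixes n :: nat
  assumes "n \<ge> 3"
  shows "det (circ (vec n jacobsthal_lucas)) =
    (2 - jacobsthal_lucas n) ^ (n - 2) * (4 - jacobsthal_lucas (n - 1)) +
    (\<Sum>k = 2..n - 1. (2 * jacobsthal_lucas k - jacobsthal_lucas (k - 1)) *
       (2 - jacobsthal_lucas n) ^ (k - 2) * (1 + 2 * jacobsthal_lucas (n - 1)) ^ (n - k))"
proof -
  obtain m where n: "n = Suc (Suc m)"
    using assms by (intro that[of "n - 2"]) simp
  let ?j = jacobsthal_lucas
  define a where "a = 2 - ?j n"
  define b where "b = 1 + 2 * ?j (n - 1)"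
  define J where "J = circ (vec n ?j)"
  have J: "J \<in> carrier_mat n n"
    by (auto simp: J_def circ_def)
  have J_index: "J $$ (i, j) = (if i \<le> j then ?j (j - i) else ?j (n + j - i))"
    if "i < n" "j < n" for i j
    using that by (simp add: J_def circ_vec_index)
  \<comment> \<open>Left multiplication by \<open>U\<close> performs all the row subtractions at
    once; as \<open>U\<close> is unitriangular, the determinant is unchanged.\<close>
  define U where "U = mat n n (\<lambda>(i, j). (if j = i then 1 else 0)
    - (if i < m \<and> j = Suc i then 1 else 0) - (if i < m \<and> j = Suc (Suc i) then 2 else 0 :: int))"
  have U: "U \<in> carrier_mat n n"
    by (simp add: U_def)
  have "det U = prod_list (diag_mat U)"
    by (rule det_upper_triangular[OF _ U]) (auto simp: U_def)
  also have "diag_mat U = map (\<lambda>i. 1) [0..<n]"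
    unfolding diag_mat_def by (intro map_cong) (auto simp: U_def)
  finally have detU: "det U = 1"
    by (simp add: map_replicate_const)
  define M where "M = mat n n (\<lambda>(i, j).
    if i < m then if j = i then a else if j = Suc i then - b else 0 else J $$ (i, j))"
  have "U * J = M"
  proof (rule eq_matI)
    fix i j
    assume "i < dim_row M" "j < dim_col M"
    then have ij: "i < n" "j < n"
      by (auto simp: M_def)
    have "(U * J) $$ (i, j) = (\<Sum>k<n. U $$ (i, k) * J $$ (k, j))"
      using ij U J by (simp add: scalar_prod_def atLeast0LessThan)
    also have "\<dots> = (\<Sum>k<n. (if k = i then J $$ (k, j) else 0)
        - (if k = Suc i then if i < m then J $$ (k, j) else 0 else 0)
        - (if k = Suc (Suc i) then if i < m then 2 * J $$ (k, j) else 0 else 0))"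
      using ij by (intro sum.cong) (auto simp: U_def)
    also have "\<dots> = J $$ (i, j)
        - (if i < m then J $$ (Suc i, j) + 2 * J $$ (Suc (Suc i), j) else 0)"
    proof (cases "i < m")
      case True
      then have "Suc i < n" "Suc (Suc i) < n"
        by (simp_all add: n)
      then show ?thesis using ij True by (simp add: sum_subtractf)
    qed (use ij in \<open>simp add: sum_subtractf\<close>)
    also have "\<dots> = M $$ (i, j)"
    proof (cases "i < m")
      case False
      then show ?thesis using ij by (simp add: M_def)
    next
      case True
      consider "j < i" | "j = i" | "j = Suc i" | "Suc (Suc i) \<le> j"
        by linarith
      then show ?thesis
      proof cases
        case 1
        \<comment> \<open>All three entries wrap around and have consecutive indices; writing them
          through \<open>e\<close> removes the truncated subtractions, so that the recurrence
          applies.\<close>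
        then obtain e where e: "n + j - i = Suc (Suc e)" "n + j - Suc i = Suc e"
            "n + j - Suc (Suc i) = e"
          using True by (intro that[of "m + j - i"]) (auto simp: n)
        show ?thesis using 1 True ij e by (simp add: J_index M_def n)
      next
        case 2
        \<comment> \<open>The two lower rows wrap around:
          \<open>?j 0 - ?j (n - 1) - 2 * ?j (n - 2) = 2 - ?j n\<close>.\<close>
        then show ?thesis using True ij by (simp add: J_index M_def n a_def)
      next
        case 3
        \<comment> \<open>Only row \<open>i + 2\<close> wraps around:
          \<open>?j 1 - ?j 0 - 2 * ?j (n - 1) = - b\<close>.\<close>
        then show ?thesis using True ij by (simp add: J_index M_def n b_def)
      next
        case 4
        then obtain d where "j = Suc (Suc i) + d"
          using le_Suc_ex by blast
        then show ?thesis using True ij by (simp add: J_index M_def n Suc_diff_le)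
      qed
    qed
    finally show "(U * J) $$ (i, j) = M $$ (i, j)" .
  qed (use U J in \<open>auto simp: M_def\<close>)
  then have detJ: "det J = det M"
    using det_mult[OF U J] detU by simp
  \<comment> \<open>Up to sign, these are the first \<open>n - 1\<close> entries of the last row
    minus twice the penultimate one. At \<open>k = m\<close> the penultimate row has reached its
    diagonal entry \<open>?j 0 = 2\<close>, which gives the separate value.\<close>
  define s where "s k = (if k < m then 2 * ?j (k + 2) - ?j (k + 1) else 4 - ?j (n - 1))" for k
  define N where "N = addrow (- 2) (n - 1) (n - 2) M"
  have N: "N \<in> carrier_mat n n"
    by (simp add: N_def M_def)
  have detM: "det M = det N"
    unfolding N_def by (rule det_addrow[symmetric, where n = n]) (auto simp: n M_def)
  \<comment> \<open>The bidiagonal rows end before this column; the last two rows hold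
    \<open>?j 1 = 1\<close> and \<open>?j 0 - 2 * ?j 1 = 0\<close>.\<close>
  have N_last: "N $$ (i, n - 1) = (if i = m then 1 else 0)" if "i < n" for i
    using that by (auto simp: N_def M_def J_index n)
  have del: "mat_delete N m (n - 1) = mat (Suc m) (Suc m) (\<lambda>(i, j).
      if i < m then if j = i then a else if j = Suc i then - b else 0 else - s j)"
    by (rule eq_matI)
       (auto simp: mat_delete_def N_def M_def J_index n s_def Suc_diff_le less_Suc_eq)
  have "det N = (\<Sum>i<n. N $$ (i, n - 1) * cofactor N i (n - 1))"
    by (rule laplace_expansion_column[OF N]) (simp add: n)
  also have "\<dots> = (\<Sum>i<n. if i = m then cofactor N i (n - 1) else 0)"
    by (intro sum.cong) (simp_all add: N_last del: One_nat_def)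
  also have "\<dots> = cofactor N m (n - 1)"
    by (simp add: n)
  \<comment> \<open>The exponent \<open>m + (n - 1) = 2 * m + 1\<close> is odd; this sign then
    cancels the one in \<open>- s j\<close>.\<close>
  also have "\<dots> = - det (mat_delete N m (n - 1))"
    by (simp add: cofactor_def n flip: mult_2)
  also have "\<dots> = (\<Sum>k\<le>m. s k * a ^ k * b ^ (m - k))"
    unfolding del det_bidiagonal_bordered by (simp add: sum_negf)
  also have "\<dots> = a ^ m * s m + (\<Sum>k<m. s k * a ^ k * b ^ (m - k))"
    by (simp flip: lessThan_Suc_atMost)
  also have "(\<Sum>k<m. s k * a ^ k * b ^ (m - k)) =
      (\<Sum>k = 2..n - 1. (2 * ?j k - ?j (k - 1)) * a ^ (k - 2) * b ^ (n - k))"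
    by (rule sum.reindex_bij_witness[of _ "\<lambda>k. k - 2" "\<lambda>k. k + 2"]) (auto simp: s_def n)
  finally show ?thesis
    using detJ detM by (simp add: J_def a_def b_def s_def n)
qed

end
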